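(* There is an algorithm that, given $n\ge 1$, $N=\{1,\dots,n\}$, $\sigma\ge 0$, $a\in\mathbb{R}^N$ with $a_i>0$ for all $i\in N$, and $c,d\in\mathbb{R}^N$, finds in $O(n^2)$ time an optimal solution of the problem $$(\mathrm{OPT})\qquad \min\Big\{ c'x+d'y+\sqrt{\sigma+\sum_{i\in N}a_i y_i^2}\ :\ \mathbf{0}\le y\le x,\ x\in\{0,1\}^N,\ y\in\mathbb{R}_+^N\Big\}.$$
   Context: $\mathbf{0}$ is the vector of zeros, $'$ denotes transpose, and vector inequalities are componentwise. Running time is the number of elementary operations on real numbers (arithmetic operations, comparisons and square roots). *)

theory Defs
  imports Complex_Main "HOL-Library.Landau_Symbols"
begin

section \<open>The optimization problem\<close>

text \<open>
  Vectors indexed by \<open>N = {1..n}\<close> are functions on \<open>nat\<close> of which only the values on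
  \<open>{1..n}\<close> are used.
\<close>

definition feasible :: "nat \<Rightarrow> (nat \<Rightarrow> real) \<Rightarrow> (nat \<Rightarrow> real) \<Rightarrow> bool" where
  "feasible n x y \<longleftrightarrow>
     (\<forall>i\<in>{1..n}. x i \<in> {0, 1}) \<and> (\<forall>i\<in>{1..n}. 0 \<le> y i \<and> y i \<le> x i)"

definition objective ::
  "nat \<Rightarrow> real \<Rightarrow> (nat \<Rightarrow> real) \<Rightarrow> (nat \<Rightarrow> real) \<Rightarrow> (nat \<Rightarrow> real) \<Rightarrow>
   (nat \<Rightarrow> real) \<Rightarrow> (nat \<Rightarrow> real) \<Rightarrow> real" where
  "objective n \<sigma> a c d x y =
     (\<Sum>i\<in>{1..n}. c i * x i) + (\<Sum>i\<in>{1..n}. d i * y i)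
       + sqrt (\<sigma> + (\<Sum>i\<in>{1..n}. a i * (y i)\<^sup>2))"

definition optimal_solution ::
  "nat \<Rightarrow> real \<Rightarrow> (nat \<Rightarrow> real) \<Rightarrow> (nat \<Rightarrow> real) \<Rightarrow> (nat \<Rightarrow> real) \<Rightarrow>
   (nat \<Rightarrow> real) \<Rightarrow> (nat \<Rightarrow> real) \<Rightarrow> bool" where
  "optimal_solution n \<sigma> a c d x y \<longleftrightarrow>
     is_arg_min (\<lambda>(x, y). objective n \<sigma> a c d x y) (\<lambda>(x, y). feasible n x y) (x, y)"


section \<open>Algorithms over the real numbers\<close>

text \<open>
  Algorithms are programs of an imperative language with natural-number variables, used for
  indices and loop control, and arrays of real numbers. A program is a finite syntactic object,
  so one program serves all input sizes. Real numbers are accessible only through the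
  arithmetic operations, square roots and comparisons; in particular there is no rounding and
  no passage from real values to indices other than by branching on comparisons.
\<close>

type_synonym name = string

record state =
  ivar :: "name \<Rightarrow> nat"
  rarr :: "name \<Rightarrow> nat \<Rightarrow> real"

datatype iexp = INum nat | IVar name | IPlus iexp iexp | IMinus iexp iexp

fun ival :: "iexp \<Rightarrow> state \<Rightarrow> nat" where
  "ival (INum k) s = k"
| "ival (IVar v) s = ivar s v"
| "ival (IPlus e f) s = ival e s + ival f s"
| "ival (IMinus e f) s = ival e s - ival f s"

datatype rexp =
    RConst int | RCell name iexp
  | RAdd rexp rexp | RSub rexp rexp | RMul rexp rexp | RDiv rexp rexp | RSqrt rexp

fun rval :: "rexp \<Rightarrow> state \<Rightarrow> real" where
  "rval (RConst k) s = of_int k"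
| "rval (RCell A e) s = rarr s A (ival e s)"
| "rval (RAdd p q) s = rval p s + rval q s"
| "rval (RSub p q) s = rval p s - rval q s"
| "rval (RMul p q) s = rval p s * rval q s"
| "rval (RDiv p q) s = rval p s / rval q s"
| "rval (RSqrt p) s = sqrt (rval p s)"

text \<open>
  Division by zero and square roots of negative numbers are total functions in HOL, but an
  algorithm must not execute them: a program that reaches one is stuck.
\<close>

fun rdef :: "rexp \<Rightarrow> state \<Rightarrow> bool" where
  "rdef (RConst k) s \<longleftrightarrow> True"
| "rdef (RCell A e) s \<longleftrightarrow> True"
| "rdef (RAdd p q) s \<longleftrightarrow> rdef p s \<and> rdef q s"
| "rdef (RSub p q) s \<longleftrightarrow> rdef p s \<and> rdef q s"
| "rdef (RMul p q) s \<longleftrightarrow> rdef p s \<and> rdef q s"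
| "rdef (RDiv p q) s \<longleftrightarrow> rdef p s \<and> rdef q s \<and> rval q s \<noteq> 0"
| "rdef (RSqrt p) s \<longleftrightarrow> rdef p s \<and> 0 \<le> rval p s"

fun rops :: "rexp \<Rightarrow> nat" where
  "rops (RConst k) = 0"
| "rops (RCell A e) = 0"
| "rops (RAdd p q) = rops p + rops q + 1"
| "rops (RSub p q) = rops p + rops q + 1"
| "rops (RMul p q) = rops p + rops q + 1"
| "rops (RDiv p q) = rops p + rops q + 1"
| "rops (RSqrt p) = rops p + 1"

datatype bexp = ILess iexp iexp | RLess rexp rexp | BNot bexp | BAnd bexp bexp

text \<open>Both arguments of \<open>BAnd\<close> are always evaluated.\<close>

fun bval :: "bexp \<Rightarrow> state \<Rightarrow> bool" where
  "bval (ILess e f) s \<longleftrightarrow> ival e s < ival f s"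
| "bval (RLess p q) s \<longleftrightarrow> rval p s < rval q s"
| "bval (BNot b) s \<longleftrightarrow> \<not> bval b s"
| "bval (BAnd b b') s \<longleftrightarrow> bval b s \<and> bval b' s"

fun bdef :: "bexp \<Rightarrow> state \<Rightarrow> bool" where
  "bdef (ILess e f) s \<longleftrightarrow> True"
| "bdef (RLess p q) s \<longleftrightarrow> rdef p s \<and> rdef q s"
| "bdef (BNot b) s \<longleftrightarrow> bdef b s"
| "bdef (BAnd b b') s \<longleftrightarrow> bdef b s \<and> bdef b' s"

fun bops :: "bexp \<Rightarrow> nat" where
  "bops (ILess e f) = 0"
| "bops (RLess p q) = rops p + rops q + 1"
| "bops (BNot b) = bops b"
| "bops (BAnd b b') = bops b + bops b'"

datatype com =
    Skip
  | IAssign name iexp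
  | RAssign name iexp rexp
  | Seq com com
  | If bexp com com
  | While bexp com

text \<open>
  \<open>exec P s t s'\<close>: started in \<open>s\<close>, the program \<open>P\<close> terminates in \<open>s'\<close> after \<open>t\<close> elementary
  operations on real numbers. Assignments and operations on indices are not counted.
\<close>

inductive exec :: "com \<Rightarrow> state \<Rightarrow> nat \<Rightarrow> state \<Rightarrow> bool" where
  Skip: "exec Skip s 0 s"
| IAssign: "exec (IAssign v e) s 0 (s\<lparr>ivar := (ivar s)(v := ival e s)\<rparr>)"
| RAssign: "rdef p s \<Longrightarrow>
    exec (RAssign A e p) s (rops p)
      (s\<lparr>rarr := (rarr s)(A := (rarr s A)(ival e s := rval p s))\<rparr>)"
| Seq: "exec P s t s' \<Longrightarrow> exec Q s' u s'' \<Longrightarrow> exec (Seq P Q) s (t + u) s''"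
| IfTrue: "bdef b s \<Longrightarrow> bval b s \<Longrightarrow> exec P s t s' \<Longrightarrow> exec (If b P Q) s (bops b + t) s'"
| IfFalse: "bdef b s \<Longrightarrow> \<not> bval b s \<Longrightarrow> exec Q s t s' \<Longrightarrow> exec (If b P Q) s (bops b + t) s'"
| WhileFalse: "bdef b s \<Longrightarrow> \<not> bval b s \<Longrightarrow> exec (While b P) s (bops b) s"
| WhileTrue: "bdef b s \<Longrightarrow> bval b s \<Longrightarrow> exec P s t s' \<Longrightarrow> exec (While b P) s' u s'' \<Longrightarrow>
    exec (While b P) s (bops b + t + u) s''"

inductive_cases SkipE: "exec Skip s t s'"
inductive_cases IAssignE: "exec (IAssign v e) s t s'"
inductive_cases RAssignE: "exec (RAssign A e p) s t s'"
inductive_cases SeqE: "exec (Seq P Q) s t s'"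
inductive_cases IfE: "exec (If b P Q) s t s'"
inductive_cases WhileE: "exec (While b P) s t s'"

lemma exec_deterministic:
  "exec P s t s' \<Longrightarrow> exec P s u s'' \<Longrightarrow> t = u \<and> s' = s''"
proof (induction arbitrary: u s'' rule: exec.induct)
  case (Seq P s t s' Q u s'')
  from Seq.prems show ?case by (rule SeqE) (use Seq.IH in blast)
next
  case (IfTrue b s P t s' Q)
  from IfTrue.prems show ?case by (rule IfE) (use IfTrue in blast)+
next
  case (IfFalse b s Q t s' P)
  from IfFalse.prems show ?case by (rule IfE) (use IfFalse in blast)+
next
  case (WhileFalse b s P)
  from WhileFalse.prems show ?case by (rule WhileE) (use WhileFalse in blast)+
next
  case (WhileTrue b s P t s' u s'')
  from WhileTrue.prems show ?case by (rule WhileE) (use WhileTrue in blast)+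
qed (auto elim: SkipE IAssignE RAssignE)

text \<open>
  Memory initially holds the input and zeros; the vectors occupy cells \<open>1..n\<close> of their arrays
  and \<open>\<sigma>\<close> occupies cell \<open>0\<close> of its array.
\<close>

definition input_state ::
  "nat \<Rightarrow> real \<Rightarrow> (nat \<Rightarrow> real) \<Rightarrow> (nat \<Rightarrow> real) \<Rightarrow> (nat \<Rightarrow> real) \<Rightarrow> state" where
  "input_state n \<sigma> a c d =
     \<lparr>ivar = (\<lambda>_. 0)(''n'' := n),
      rarr = (\<lambda>_ _. 0)(
        ''sigma'' := (\<lambda>_. 0)(0 := \<sigma>),
        ''a'' := (\<lambda>i. if i \<in> {1..n} then a i else 0),
        ''c'' := (\<lambda>i. if i \<in> {1..n} then c i else 0),
        ''d'' := (\<lambda>i. if i \<in> {1..n} then d i else 0))\<rparr>"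

end

theory Submission
  imports Defs
begin

text \<open>
  For every \<open>s \<ge> 0\<close> the number \<open>sqrt s\<close> is the infimum of \<open>t / 2 + s / (2 * t)\<close> over \<open>t > 0\<close>,
  attained at \<open>t = sqrt s\<close> if \<open>s > 0\<close>. Writing the root in the objective in this way, the problem
  splits, for each fixed \<open>t\<close>, into \<open>n\<close> problems in one pair \<open>(x i, y i)\<close>, which are solved in closed
  form. Let \<open>dual t\<close> be the resulting minimum and \<open>x_at t\<close>, \<open>y_at t\<close> the solution that attains it.
  Then \<open>x_at t\<close>, \<open>y_at t\<close> costs at most \<open>dual t\<close> in the original problem (\<open>value_at_le_dual\<close>),
  and a feasible point with root \<open>t > 0\<close> costs at least \<open>dual t\<close> (\<open>dual_le_objective\<close>). So it is
  enough to have, below every value of \<open>dual\<close>, one of finitely many candidates.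

  As \<open>t\<close> grows, an item changes its behaviour at most twice: its fractional level reaches \<open>1\<close>
  at the saturation point, and it becomes worth its fixed cost \<open>c\<close> at the entry point. Together
  with \<open>0\<close> this gives at most \<open>2 * n + 1\<close> breakpoints, and from one breakpoint to the next
  \<open>dual\<close> has the form \<open>K + A * t / 2 + B / (2 * t)\<close> with constants that can be computed at the
  left end (\<open>dual_eq_piece\<close>). Such a function is minimal on an interval at an endpoint or at
  \<open>sqrt (B / A)\<close>, or else it decreases towards \<open>t = 0\<close>, where the candidate with \<open>y = 0\<close>
  takes over. The breakpoints and the points \<open>sqrt (B / A)\<close> computed at them are therefore
  \<open>4 * n + 2\<close> sufficient candidates (\<open>candidate_below_dual\<close>).

  One linear pass over the items evaluates a candidate \<open>t\<close>: it produces \<open>x_at t\<close>, \<open>y_at t\<close>, their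
  objective value and \<open>sqrt (B / A)\<close>. The program makes one such pass per candidate and a last
  one to restore the best candidate, hence a quadratic number of operations and no sorting.
\<close>

section \<open>Reasoning about programs\<close>

definition runs :: "com \<Rightarrow> state \<Rightarrow> nat \<Rightarrow> (state \<Rightarrow> bool) \<Rightarrow> bool" where
  "runs P s T Q \<longleftrightarrow> (\<exists>t s'. exec P s t s' \<and> t \<le> T \<and> Q s')"

lemma runs_mono:
  "runs P s T Q \<Longrightarrow> T \<le> T' \<Longrightarrow> (\<And>s. Q s \<Longrightarrow> Q' s) \<Longrightarrow> runs P s T' Q'"
  unfolding runs_def using order_trans by blast

lemma runs_Seq:
  assumes "runs P s t R" "\<And>s'. R s' \<Longrightarrow> runs P' s' u Q"
  shows "runs (Seq P P') s (t + u) Q"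
  using assms unfolding runs_def by (meson exec.Seq add_mono)

text \<open>
  Loop-free code is verified by computing weakest preconditions, which the simplifier can unfold;
  loops are treated by \<open>runs_for\<close> instead, so the value of \<open>wp\<close> and \<open>max_ops\<close> on them is arbitrary
  as long as \<open>runs_wp\<close> remains true.
\<close>

fun wp :: "com \<Rightarrow> (state \<Rightarrow> bool) \<Rightarrow> state \<Rightarrow> bool" where
  "wp Skip Q s \<longleftrightarrow> Q s"
| "wp (IAssign v e) Q s \<longleftrightarrow> Q (s\<lparr>ivar := (ivar s)(v := ival e s)\<rparr>)"
| "wp (RAssign A e p) Q s \<longleftrightarrow>
     rdef p s \<and> Q (s\<lparr>rarr := (rarr s)(A := (rarr s A)(ival e s := rval p s))\<rparr>)"
| "wp (Seq P P') Q s \<longleftrightarrow> wp P (wp P' Q) s"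
| "wp (If b P P') Q s \<longleftrightarrow> bdef b s \<and> (if bval b s then wp P Q s else wp P' Q s)"
| "wp (While b P) Q s \<longleftrightarrow> False"

fun max_ops :: "com \<Rightarrow> nat" where
  "max_ops Skip = 0"
| "max_ops (IAssign v e) = 0"
| "max_ops (RAssign A e p) = rops p"
| "max_ops (Seq P P') = max_ops P + max_ops P'"
| "max_ops (If b P P') = bops b + max (max_ops P) (max_ops P')"
| "max_ops (While b P) = 0"

lemma runs_wp: "wp P Q s \<Longrightarrow> runs P s (max_ops P) Q"
proof (induction P arbitrary: Q s)
  case (Seq P P')
  then show ?case by (auto intro!: runs_Seq)
next
  case (If b P P')
  show ?case
  proof (cases "bval b s")
    case True
    then have "runs P s (max_ops P) Q" using If by auto
    then show ?thesis using True If.prems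
      unfolding runs_def by simp (metis exec.IfTrue add_left_mono max.coboundedI1)
  next
    case False
    then have "runs P' s (max_ops P') Q" using If by auto
    then show ?thesis using False If.prems
      unfolding runs_def by simp (metis exec.IfFalse add_left_mono max.coboundedI2)
  qed
qed (auto simp: runs_def intro: exec.intros)

text \<open>
  All loops of the program below are counting loops with guards that only compare indices. The
  value of the counter is the argument of the invariant \<open>I\<close>, and \<open>C\<close> bounds the cost of one round.
\<close>

lemma runs_for:
  assumes "lo \<le> hi" "I lo s" "bops b = 0"
    and guard: "\<And>j s. j \<le> hi \<Longrightarrow> I j s \<Longrightarrow> bdef b s \<and> (bval b s \<longleftrightarrow> j < hi)"
    and body: "\<And>j s. lo \<le> j \<Longrightarrow> j < hi \<Longrightarrow> I j s \<Longrightarrow> runs P s C (I (Suc j))"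
  shows "runs (While b P) s ((hi - lo) * C) (I hi)"
proof -
  have "runs (While b P) s ((hi - j) * C) (I hi)" if "lo \<le> j" "j \<le> hi" "I j s" for j s
    using that
  proof (induction "hi - j" arbitrary: j s)
    case 0
    then have "j = hi" by simp
    then have "exec (While b P) s 0 s"
      using exec.WhileFalse[of b s P] guard[of j s] 0 \<open>bops b = 0\<close> by simp
    then show ?case using 0 \<open>j = hi\<close> unfolding runs_def by blast
  next
    case (Suc k)
    then have "j < hi" by simp
    then obtain t s' where 1: "exec P s t s'" "t \<le> C" "I (Suc j) s'"
      using body[of j s] Suc.prems unfolding runs_def by auto
    have "runs (While b P) s' ((hi - Suc j) * C) (I hi)"
      using Suc.hyps(1)[of "Suc j" s'] Suc.hyps(2) Suc.prems 1 \<open>j < hi\<close> by simp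
    then obtain u s'' where 2: "exec (While b P) s' u s''" "u \<le> (hi - Suc j) * C" "I hi s''"
      unfolding runs_def by auto
    have "exec (While b P) s (0 + t + u) s''"
      using exec.WhileTrue[of b s P t s' u s''] guard[of j s] Suc.prems \<open>j < hi\<close> 1 2
        \<open>bops b = 0\<close> by simp
    moreover have "t + u \<le> C + (hi - Suc j) * C" using 1 2 by simp
    moreover have "C + (hi - Suc j) * C = (hi - j) * C"
      using \<open>j < hi\<close> by (metis Suc_diff_Suc mult_Suc)
    ultimately show ?case using 2 unfolding runs_def by auto
  qed
  then show ?thesis using assms(1,2) by blast
qed

section \<open>One item\<close>

text \<open>
  For a multiplier \<open>t\<close> and an item with data \<open>a > 0\<close>, \<open>c\<close>, \<open>d\<close>, the task is to minimise
  \<open>d * y + a * y\<^sup>2 / (2 * t)\<close> over \<open>0 \<le> y \<le> 1\<close>. The minimiser \<open>level\<close> is the stationary point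
  \<open>- d * t / a\<close> if that lies below \<open>1\<close> (interior case), \<open>1\<close> if it does not (saturated case), and \<open>0\<close>
  if \<open>d \<ge> 0\<close>. The \<open>price\<close> is the minimum plus the fixed cost \<open>c\<close>. The interior formula does not
  divide by \<open>t\<close>, which extends both functions to \<open>t = 0\<close>.
\<close>

definition interior :: "real \<Rightarrow> real \<Rightarrow> real \<Rightarrow> bool" where
  "interior a d t \<longleftrightarrow> d < 0 \<and> - d * t < a"

definition saturated :: "real \<Rightarrow> real \<Rightarrow> real \<Rightarrow> bool" where
  "saturated a d t \<longleftrightarrow> d < 0 \<and> a \<le> - d * t"

definition level :: "real \<Rightarrow> real \<Rightarrow> real \<Rightarrow> real" where
  "level a d t = (if interior a d t then - d * t / a else if saturated a d t then 1 else 0)"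

definition price :: "real \<Rightarrow> real \<Rightarrow> real \<Rightarrow> real \<Rightarrow> real" where
  "price a c d t = (if interior a d t then c + d * level a d t / 2
     else if saturated a d t then c + d + a / (2 * t) else c)"

text \<open>
  An item is selected if its price is not positive. The next three functions are the coefficients
  of the contribution \<open>min 0 (price a c d t)\<close> of an item,
  \<open>base - gain * t / 2 + load / (2 * t)\<close>, where the case is the one that holds at \<open>t\<close>.
  Selecting at price \<open>0\<close> makes them continuous from the right in \<open>t\<close>.
\<close>

definition base :: "real \<Rightarrow> real \<Rightarrow> real \<Rightarrow> real \<Rightarrow> real" where
  "base a c d t = (if price a c d t \<le> 0 then (if saturated a d t then c + d else c) else 0)"

definition gain :: "real \<Rightarrow> real \<Rightarrow> real \<Rightarrow> real \<Rightarrow> real" where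
  "gain a c d t = (if price a c d t \<le> 0 \<and> interior a d t then d * d / a else 0)"

definition load :: "real \<Rightarrow> real \<Rightarrow> real \<Rightarrow> real \<Rightarrow> real" where
  "load a c d t = (if price a c d t \<le> 0 \<and> saturated a d t then a else 0)"

definition saturation_point :: "real \<Rightarrow> real \<Rightarrow> real" where
  "saturation_point a d = (if d < 0 then a / (- d) else 0)"

text \<open>
  For \<open>d < 0\<close> the price decreases in \<open>t\<close>, first as \<open>c - d\<^sup>2 * t / (2 * a)\<close> and beyond the saturation
  point as \<open>c + d + a / (2 * t)\<close>. The entry point is its zero if \<open>c > 0\<close>; at the saturation
  point the price is \<open>c + d / 2\<close>, whose sign tells the branch that contains the zero. Items
  without such a point get \<open>0\<close>, which is a candidate anyway.
\<close>

definition entry_point :: "real \<Rightarrow> real \<Rightarrow> real \<Rightarrow> real" where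
  "entry_point a c d =
     (if d < 0 \<and> 0 < c then
        (if - d < 2 * c then (if c + d < 0 then a / (- 2 * (c + d)) else 0)
         else 2 * a * c / (d * d))
      else 0)"

lemma level_bounds: "0 < a \<Longrightarrow> 0 \<le> t \<Longrightarrow> 0 \<le> level a d t \<and> level a d t \<le> 1"
  by (auto simp: level_def interior_def saturated_def divide_simps mult_nonpos_nonneg)

lemma price_eq:
  assumes "0 < a" "0 < t"
  shows "price a c d t = c + d * level a d t + a * (level a d t)\<^sup>2 / (2 * t)"
  using assms
  by (auto simp: price_def level_def field_simps power2_eq_square)

lemma price_le:
  assumes "0 < a" "0 < t" "0 \<le> y" "y \<le> 1"
  shows "price a c d t \<le> c + d * y + a * y\<^sup>2 / (2 * t)"
proof -
  consider "interior a d t" | "saturated a d t" "\<not> interior a d t" | "0 \<le> d"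
    unfolding interior_def saturated_def by linarith
  then show ?thesis
  proof cases
    case 1
    define l where "l = level a d t"
    have l: "a * l = - d * t" using 1 assms unfolding l_def level_def by simp
    have "c + d * y + a * y\<^sup>2 / (2 * t) - (c + d * l / 2) = a / (2 * t) * (y - l)\<^sup>2"
    proof -
      have d: "d = - a * l / t" using l assms by (simp add: field_simps)
      show ?thesis unfolding d using assms by (simp add: field_simps power2_eq_square)
    qed
    also have "\<dots> \<ge> 0" using assms by simp
    finally show ?thesis using 1 by (simp add: price_def l_def)
  next
    case 2
    define q where "q = a / t"
    have "q \<le> - d" using 2 assms unfolding saturated_def q_def by (simp add: field_simps)
    moreover have "q * (1 + y) \<le> q * 2"
      using assms by (intro mult_left_mono) (auto simp: q_def)
    ultimately have "0 \<le> - d - q * (1 + y) / 2" by linarith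
    then have "0 \<le> (1 - y) * (- d - q * (1 + y) / 2)" using assms by simp
    also have "\<dots> = c + d * y + a * y\<^sup>2 / (2 * t) - (c + d + a / (2 * t))"
      using assms by (simp add: q_def field_simps power2_eq_square)
    finally show ?thesis using 2 by (simp add: price_def)
  next
    case 3
    then show ?thesis using assms by (simp add: price_def interior_def saturated_def)
  qed
qed

text \<open>The boundary case \<open>- d * t = a\<close> is included: the two branches of the price agree there.\<close>

lemma price_interior:
  assumes "d < 0" "0 < a" "0 < t" "- d * t \<le> a"
  shows "price a c d t = c - d * d / a * t / 2"
  using assms
  by (auto simp: price_def level_def interior_def saturated_def field_simps)

lemma price_saturated:
  assumes "a \<le> - d * t" "d < 0"
  shows "price a c d t = c + d + a / (2 * t)"
  using assms by (auto simp: price_def interior_def saturated_def)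

text \<open>
  Between \<open>b\<close> and the next of its two breakpoints an item keeps its case and its selection, so
  the coefficients taken at \<open>b\<close> stay valid. They do so up to and including that breakpoint,
  by continuity of the price at the saturation point and because the price vanishes at the entry point.
\<close>

lemma min_price_piece:
  assumes "0 < a" "0 \<le> b" "b \<le> t" "0 < t"
    and sat: "saturation_point a d \<notin> {b<..<t}" and ent: "entry_point a c d \<notin> {b<..<t}"
  shows "min 0 (price a c d t) =
    base a c d b - gain a c d b * t / 2 + load a c d b / (2 * t)"
proof -
  consider "interior a d b" | "saturated a d b" "\<not> interior a d b" | "0 \<le> d"
    unfolding interior_def saturated_def by linarith
  then show ?thesis
  proof cases
    case 1
    then have d: "d < 0" "- d * b < a" by (auto simp: interior_def)
    then have nsat: "\<not> saturated a d b" by (auto simp: saturated_def)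
    have "b < saturation_point a d"
      using d assms(1) by (simp add: saturation_point_def field_simps)
    then have "t \<le> saturation_point a d" using sat by auto
    then have "- d * t \<le> a"
      using d assms(1) by (simp add: saturation_point_def field_simps)
    define g where "g = d * d / a"
    have pt: "price a c d t = c - g * t / 2"
      using price_interior d assms \<open>- d * t \<le> a\<close> unfolding g_def by blast
    have pb: "price a c d b = c - g * b / 2"
      using 1 assms(1) by (simp add: price_def level_def g_def)
    have g: "0 < g" using d assms(1) by (simp add: g_def mult_neg_neg)
    show ?thesis
    proof (cases "price a c d b \<le> 0")
      case True
      have "g * b \<le> g * t" using g assms by (intro mult_left_mono) auto
      then have "price a c d t \<le> 0" using True pt pb by linarith
      then show ?thesis using True pt 1 nsat by (simp add: base_def gain_def load_def g_def)
    next
      case False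
      have "0 \<le> price a c d t"
      proof (rule ccontr)
        assume neg: "\<not> 0 \<le> price a c d t"
        then have lt: "2 * c < g * t" using pt by linarith
        have gt: "g * b < 2 * c" using False pb by linarith
        have "0 \<le> g * b" using g assms by simp
        then have "0 < c" using gt by linarith
        \<comment> \<open>The zero of the interior branch lies in the open interval, and it comes before
          saturation, so it is the entry point.\<close>
        have le_1: "- d * t / a \<le> 1"
          using \<open>- d * t \<le> a\<close> assms(1) by (subst divide_le_eq_1_pos)
        have "g * t = (- d) * ((- d * t) / a)" by (simp add: g_def)
        also have "\<dots> \<le> (- d) * 1"
          using d le_1 by (intro mult_left_mono) auto
        finally have "2 * c \<le> - d" using lt by linarith
        then have e: "entry_point a c d = 2 * c / (g)"
          using d \<open>0 < c\<close> by (simp add: entry_point_def g_def)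
        have "b < entry_point a c d" "entry_point a c d < t"
          unfolding e using g lt gt
          by (simp_all only: pos_less_divide_eq pos_divide_less_eq mult.commute)
        then show False using ent by simp
      qed
      then show ?thesis using False by (simp add: base_def gain_def load_def g_def)
    qed
  next
    case 2
    then have d: "d < 0" "a \<le> - d * b" by (auto simp: saturated_def)
    then have "b \<noteq> 0" using assms(1) by auto
    then have b: "0 < b" using assms by simp
    have "- d * b \<le> - d * t" using d assms by (intro mult_left_mono) auto
    then have "a \<le> - d * t" using d(2) by linarith
    then have pt: "price a c d t = c + d + a / (2 * t)" using d by (intro price_saturated)
    have pb: "price a c d b = c + d + a / (2 * b)" using d by (intro price_saturated) auto
    show ?thesis
    proof (cases "price a c d b \<le> 0")
      case True
      have "a / (2 * t) \<le> a / (2 * b)" using assms b by (intro divide_left_mono) auto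
      then have "price a c d t \<le> 0" using True pt pb by linarith
      then show ?thesis using True pt 2 by (simp add: base_def gain_def load_def)
    next
      case False
      have "0 \<le> price a c d t"
      proof (rule ccontr)
        assume "\<not> 0 \<le> price a c d t"
        then have lt: "a / (2 * t) < - (c + d)" using pt by linarith
        have gt: "- (c + d) < a / (2 * b)" using False pb by linarith
        have "0 < a / (2 * t)" using assms by simp
        then have neg: "c + d < 0" using lt by linarith
        \<comment> \<open>A positive price at a saturated \<open>b\<close> means that it was positive at saturation too,
          so the entry point is the zero of the saturated branch.\<close>
        have "a / (2 * b) \<le> - d / 2" using d b by (simp add: field_simps)
        then have "- d < 2 * c" using gt by (simp add: field_simps)
        then have e: "entry_point a c d = a / (- 2 * (c + d))"
          using d neg by (simp add: entry_point_def)
        have "b < entry_point a c d" "entry_point a c d < t"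
          unfolding e using lt gt neg b assms(4) by (simp_all add: field_simps)
        then show False using ent by simp
      qed
      then show ?thesis using False by (simp add: base_def gain_def load_def)
    qed
  next
    case 3
    then show ?thesis
      by (simp add: price_def interior_def saturated_def base_def gain_def load_def)
  qed
qed

lemma item_breakpoints_nonneg:
  assumes "0 < a" shows "0 \<le> saturation_point a d" "0 \<le> entry_point a c d"
  using assms by (auto simp: saturation_point_def entry_point_def divide_simps mult_less_0_iff)

section \<open>Finitely many candidates suffice\<close>

locale mean_risk =
  fixes n :: nat and \<sigma> :: real and a c d :: "nat \<Rightarrow> real"
  assumes \<sigma>: "0 \<le> \<sigma>" and a: "\<And>i. i \<in> {1..n} \<Longrightarrow> 0 < a i"
begin

definition x_at :: "real \<Rightarrow> nat \<Rightarrow> real" where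
  "x_at t i = (if price (a i) (c i) (d i) t \<le> 0 then 1 else 0)"

definition y_at :: "real \<Rightarrow> nat \<Rightarrow> real" where
  "y_at t i = (if price (a i) (c i) (d i) t \<le> 0 then level (a i) (d i) t else 0)"

definition value_at :: "real \<Rightarrow> real" where
  "value_at t = objective n \<sigma> a c d (x_at t) (y_at t)"

definition dual :: "real \<Rightarrow> real" where
  "dual t = t / 2 + \<sigma> / (2 * t) + (\<Sum>i\<in>{1..n}. min 0 (price (a i) (c i) (d i) t))"

text \<open>
  With the case and selection of every item taken at \<open>b\<close>, the sum of all terms is
  \<open>K + lin_coeff b * t / 2 + inv_coeff b / (2 * t)\<close>. If both coefficients are positive, this is
  minimal over \<open>t > 0\<close> at \<open>stationary b\<close>. If \<open>lin_coeff b \<le> 0\<close>, it never increases, and \<open>0\<close> is a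
  placeholder that is a candidate anyway.
\<close>

definition lin_coeff :: "real \<Rightarrow> real" where
  "lin_coeff b = 1 - (\<Sum>i\<in>{1..n}. gain (a i) (c i) (d i) b)"

definition inv_coeff :: "real \<Rightarrow> real" where
  "inv_coeff b = \<sigma> + (\<Sum>i\<in>{1..n}. load (a i) (c i) (d i) b)"

definition stationary :: "real \<Rightarrow> real" where
  "stationary b = (if 0 < lin_coeff b then sqrt (inv_coeff b / lin_coeff b) else 0)"

definition breakpoints :: "real set" where
  "breakpoints = insert 0 ((\<lambda>i. saturation_point (a i) (d i)) ` {1..n}
     \<union> (\<lambda>i. entry_point (a i) (c i) (d i)) ` {1..n})"

abbreviation candidates :: "real set" where
  "candidates \<equiv> breakpoints \<union> stationary ` breakpoints"

lemma inv_coeff_nonneg: "0 \<le> inv_coeff b"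
  unfolding inv_coeff_def using \<sigma> a
  by (intro add_nonneg_nonneg sum_nonneg) (auto simp: load_def less_imp_le)

lemma stationary_nonneg: "0 \<le> stationary b"
  using inv_coeff_nonneg by (auto simp: stationary_def)

lemma breakpoints: "finite breakpoints" "0 \<in> breakpoints" "\<And>b. b \<in> breakpoints \<Longrightarrow> 0 \<le> b"
  using a item_breakpoints_nonneg by (auto simp: breakpoints_def)

lemma feasible_candidate: "0 \<le> t \<Longrightarrow> feasible n (x_at t) (y_at t)"
  using a level_bounds by (auto simp: feasible_def x_at_def y_at_def)

lemma sqrt_le:
  assumes "0 < t" "0 \<le> s" shows "sqrt s \<le> t / 2 + s / (2 * t)"
proof -
  have "0 \<le> (t - sqrt s)\<^sup>2 / (2 * t)" using assms by simp
  also have "\<dots> = t / 2 + s / (2 * t) - sqrt s"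
    using assms by (simp add: power2_diff field_simps) (simp add: power2_eq_square)
  finally show ?thesis by simp
qed

lemma value_at_le_dual:
  assumes "0 < t" shows "value_at t \<le> dual t"
proof -
  let ?s = "\<sigma> + (\<Sum>i\<in>{1..n}. a i * (y_at t i)\<^sup>2)"
  have "0 \<le> ?s" using \<sigma> a by (intro add_nonneg_nonneg sum_nonneg) (auto simp: less_imp_le)
  then have "sqrt ?s \<le> t / 2 + ?s / (2 * t)" using assms sqrt_le by blast
  moreover have "(\<Sum>i\<in>{1..n}. min 0 (price (a i) (c i) (d i) t)) =
     (\<Sum>i\<in>{1..n}. c i * x_at t i + d i * y_at t i + a i * (y_at t i)\<^sup>2 / (2 * t))"
    using assms a price_eq by (intro sum.cong) (auto simp: x_at_def y_at_def)
  ultimately show ?thesis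
    unfolding value_at_def objective_def dual_def
    by (simp add: sum.distrib add_divide_distrib sum_divide_distrib)
qed

text \<open>
  At \<open>t = sqrt s\<close> the bound \<open>sqrt s \<le> t / 2 + s / (2 * t)\<close> is an equality, so passing to the
  separated problem loses nothing for the given point.
\<close>

lemma dual_le_objective:
  assumes "feasible n x y" "0 < \<sigma> + (\<Sum>i\<in>{1..n}. a i * (y i)\<^sup>2)"
  shows "dual (sqrt (\<sigma> + (\<Sum>i\<in>{1..n}. a i * (y i)\<^sup>2))) \<le> objective n \<sigma> a c d x y"
proof -
  define s where "s = \<sigma> + (\<Sum>i\<in>{1..n}. a i * (y i)\<^sup>2)"
  define t where "t = sqrt s"
  have t: "0 < t" "s = t * t" using assms by (auto simp: s_def t_def)
  have "(\<Sum>i\<in>{1..n}. min 0 (price (a i) (c i) (d i) t)) \<le>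
     (\<Sum>i\<in>{1..n}. c i * x i + d i * y i + a i * (y i)\<^sup>2 / (2 * t))"
  proof (rule sum_mono)
    fix i assume i: "i \<in> {1..n}"
    then have y: "x i = 0 \<or> x i = 1" "0 \<le> y i" "y i \<le> x i"
      using assms unfolding feasible_def by auto
    show "min 0 (price (a i) (c i) (d i) t) \<le> c i * x i + d i * y i + a i * (y i)\<^sup>2 / (2 * t)"
      using y price_le[OF a[OF i] t(1) y(2), of "c i" "d i"] by auto
  qed
  also have "\<dots> = (\<Sum>i\<in>{1..n}. c i * x i) + (\<Sum>i\<in>{1..n}. d i * y i) + (s - \<sigma>) / (2 * t)"
    by (simp add: s_def sum.distrib sum_divide_distrib)
  finally have "dual t \<le> (\<Sum>i\<in>{1..n}. c i * x i) + (\<Sum>i\<in>{1..n}. d i * y i) + t / 2 + s / (2 * t)"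
    unfolding dual_def by (simp add: diff_divide_distrib)
  also have "s / (2 * t) = t / 2" using t by simp
  finally show ?thesis unfolding objective_def s_def[symmetric] t_def[symmetric] by simp
qed

text \<open>
  The multiplier \<open>0\<close> stands for the limit of \<open>t\<close> tending to \<open>0\<close>: all levels vanish and the items with
  \<open>c \<le> 0\<close> are selected. It settles the feasible points whose root is \<open>0\<close>.
\<close>

lemma value_at_0: "value_at 0 = (\<Sum>i\<in>{1..n}. min 0 (c i)) + sqrt \<sigma>"
proof -
  have p: "price (a i) (c i) (d i) 0 = c i" "level (a i) (d i) 0 = 0" if "i \<in> {1..n}" for i
    using a[OF that] by (auto simp: price_def level_def interior_def saturated_def)
  have "(\<Sum>i\<in>{1..n}. c i * x_at 0 i) = (\<Sum>i\<in>{1..n}. min 0 (c i))"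
    "(\<Sum>i\<in>{1..n}. d i * y_at 0 i) = 0" "(\<Sum>i\<in>{1..n}. a i * (y_at 0 i)\<^sup>2) = 0"
    using p by (auto intro!: sum.cong sum.neutral simp: x_at_def y_at_def)
  then show ?thesis by (simp add: value_at_def objective_def)
qed

lemma value_at_0_le_objective:
  assumes "feasible n x y" "\<sigma> + (\<Sum>i\<in>{1..n}. a i * (y i)\<^sup>2) = 0"
  shows "value_at 0 \<le> objective n \<sigma> a c d x y"
proof -
  have nn: "0 \<le> a i * (y i)\<^sup>2" if "i \<in> {1..n}" for i using a[OF that] by simp
  then have "0 \<le> (\<Sum>i\<in>{1..n}. a i * (y i)\<^sup>2)" by (intro sum_nonneg)
  then have z: "\<sigma> = 0" "(\<Sum>i\<in>{1..n}. a i * (y i)\<^sup>2) = 0" using \<sigma> assms(2) by linarith+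
  have y: "y i = 0" if "i \<in> {1..n}" for i
  proof -
    have "a i * (y i)\<^sup>2 = 0"
      using z(2) nn that sum_nonneg_eq_0_iff[of "{1..n}" "\<lambda>i. a i * (y i)\<^sup>2"] by blast
    then show ?thesis using a[OF that] by simp
  qed
  have "(\<Sum>i\<in>{1..n}. min 0 (c i)) \<le> (\<Sum>i\<in>{1..n}. c i * x i)"
  proof (rule sum_mono)
    fix i assume "i \<in> {1..n}"
    then have "x i = 0 \<or> x i = 1" using assms(1) by (auto simp: feasible_def)
    then show "min 0 (c i) \<le> c i * x i" by auto
  qed
  then show ?thesis unfolding value_at_0 objective_def using y z by simp
qed

definition piece :: "real \<Rightarrow> real \<Rightarrow> real" where
  "piece b t = (\<Sum>i\<in>{1..n}. base (a i) (c i) (d i) b) + lin_coeff b * t / 2 + inv_coeff b / (2 * t)"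

lemma dual_eq_piece:
  assumes "0 \<le> b" "b \<le> t" "0 < t" "breakpoints \<inter> {b<..<t} = {}"
  shows "dual t = piece b t"
proof -
  have "(\<Sum>i\<in>{1..n}. min 0 (price (a i) (c i) (d i) t)) = (\<Sum>i\<in>{1..n}.
    base (a i) (c i) (d i) b - gain (a i) (c i) (d i) b * t / 2 + load (a i) (c i) (d i) b / (2 * t))"
  proof (rule sum.cong)
    fix i assume i: "i \<in> {1..n}"
    then have "saturation_point (a i) (d i) \<in> breakpoints" "entry_point (a i) (c i) (d i) \<in> breakpoints"
      by (auto simp: breakpoints_def)
    then show "min 0 (price (a i) (c i) (d i) t) =
      base (a i) (c i) (d i) b - gain (a i) (c i) (d i) b * t / 2 + load (a i) (c i) (d i) b / (2 * t)"
      using assms i a by (intro min_price_piece) blast+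
  qed simp
  also have "\<dots> = (\<Sum>i\<in>{1..n}. base (a i) (c i) (d i) b)
      - (\<Sum>i\<in>{1..n}. gain (a i) (c i) (d i) b) * t / 2
      + (\<Sum>i\<in>{1..n}. load (a i) (c i) (d i) b) / (2 * t)"
    by (simp add: sum.distrib sum_subtractf sum_distrib_right sum_divide_distrib)
  finally show ?thesis
    unfolding dual_def piece_def lin_coeff_def inv_coeff_def
    by (simp add: add_divide_distrib left_diff_distrib diff_divide_distrib)
qed

lemma piece_diff:
  assumes "0 < t" "0 < w"
  shows "piece b t - piece b w = (t - w) / 2 * (lin_coeff b - inv_coeff b / (t * w))"
  using assms by (simp add: piece_def field_simps)

text \<open>
  Beyond all saturation points no item is interior, so \<open>dual\<close> eventually increases and its
  last piece has a finite minimiser.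
\<close>

lemma lin_coeff_last:
  assumes "breakpoints \<inter> {b<..} = {}"
  shows "lin_coeff b = 1"
proof -
  have "gain (a i) (c i) (d i) b = 0" if i: "i \<in> {1..n}" for i
  proof (rule ccontr)
    assume "gain (a i) (c i) (d i) b \<noteq> 0"
    then have "interior (a i) (d i) b" by (auto simp: gain_def split: if_splits)
    then have "b < saturation_point (a i) (d i)"
      using a[OF i] by (simp add: interior_def saturation_point_def field_simps)
    moreover have "saturation_point (a i) (d i) \<in> breakpoints" using i by (auto simp: breakpoints_def)
    ultimately show False using assms by auto
  qed
  then show ?thesis by (simp add: lin_coeff_def)
qed

text \<open>
  Let \<open>b < t < u\<close> with \<open>b\<close> and \<open>u\<close> neighbouring breakpoints, or no \<open>u\<close> if \<open>b\<close> is the last one. By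
  \<open>piece_diff\<close>, moving from \<open>t\<close> to \<open>w\<close> within the piece does not increase \<open>dual\<close> as soon as
  \<open>lin_coeff b * (t * w) - inv_coeff b\<close> has the sign of \<open>t - w\<close> or is \<open>0\<close>. If this admits neither
  \<open>w = u\<close> nor \<open>w = b\<close>, then \<open>stationary b\<close> lies between them and is such a \<open>w\<close>, unless it is \<open>0\<close>.
  In that last case \<open>b = 0\<close> and \<open>\<sigma> = 0\<close>, and the piece increases from its limit at \<open>0\<close>, which is
  \<open>value_at 0\<close>.
\<close>

lemma candidate_below_dual:
  assumes t: "0 < t"
  shows "\<exists>w \<in> candidates. value_at w \<le> dual t"
proof (cases "t \<in> breakpoints")
  case True
  then show ?thesis using value_at_le_dual[OF t] by blast
next
  case False
  define b where "b = Max {b \<in> breakpoints. b < t}"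
  have fin: "finite {b \<in> breakpoints. b < t}" "0 \<in> {b \<in> breakpoints. b < t}" using breakpoints t by auto
  then have b: "b \<in> breakpoints" "b < t" using Max_in[OF fin(1)] unfolding b_def by blast+
  have b0: "0 \<le> b" using breakpoints b by auto
  have upto_t: "u \<le> b \<or> t < u" if "u \<in> breakpoints" for u
  proof (cases "u < t")
    case True
    then show ?thesis using Max_ge[OF fin(1), of u] that unfolding b_def by simp
  next
    case nless: False
    have "u \<noteq> t" using that False by blast
    then show ?thesis using nless by simp
  qed
  have gap: "breakpoints \<inter> {b<..<x} = {}" if x: "\<And>u. u \<in> breakpoints \<Longrightarrow> t < u \<Longrightarrow> x \<le> u" for x
  proof (rule equals0I)
    fix u assume "u \<in> breakpoints \<inter> {b<..<x}"
    then have u: "u \<in> breakpoints" "b < u" "u < x" by auto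
    then have "t < u" using upto_t[OF u(1)] by linarith
    then show False using x[OF u(1)] u(3) by linarith
  qed
  have dual_t: "dual t = piece b t"
    using b b0 t gap[of t] by (intro dual_eq_piece) simp_all
  define U where "U = {u \<in> breakpoints. t < u}"
  have finU: "finite U" using breakpoints by (simp add: U_def)
  have win: ?thesis
    if "b \<le> w" "0 < w" "breakpoints \<inter> {b<..<w} = {}" "w \<in> candidates"
       "0 \<le> (t - w) * (lin_coeff b * (t * w) - inv_coeff b)" for w
  proof -
    have "0 \<le> (t - w) * (lin_coeff b * (t * w) - inv_coeff b) / (2 * (t * w))" using that t by simp
    also have "\<dots> = piece b t - piece b w"
      using that t by (simp add: piece_diff field_simps)
    also have "piece b w = dual w" using that b0 by (intro dual_eq_piece[symmetric])
    finally have "value_at w \<le> dual t" using value_at_le_dual[OF that(2)] dual_t by linarith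
    then show ?thesis using that(4) by blast
  qed
  have b_cases: "b = 0 \<or> 0 < b" using b0 by linarith
  consider (up) "U \<noteq> {}" "lin_coeff b * (t * Min U) \<le> inv_coeff b"
    | (down) "0 < b" "inv_coeff b \<le> lin_coeff b * (t * b)"
    | (mid) "U = {} \<or> inv_coeff b < lin_coeff b * (t * Min U)" "b = 0 \<or> lin_coeff b * (t * b) < inv_coeff b"
    using b_cases not_le by blast
  then show ?thesis
  proof cases
    case up
    then have "Min U \<in> U" using finU by simp
    then have u: "Min U \<in> breakpoints" "t < Min U" by (auto simp: U_def)
    have "breakpoints \<inter> {b<..<Min U} = {}"
      by (rule gap) (use Min_le[OF finU] in \<open>simp add: U_def\<close>)
    moreover have "0 \<le> (t - Min U) * (lin_coeff b * (t * Min U) - inv_coeff b)"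
      using u up by (intro mult_nonpos_nonpos) simp_all
    ultimately show ?thesis using u b t by (intro win[of "Min U"]) simp_all
  next
    case down
    then have "0 \<le> (t - b) * (lin_coeff b * (t * b) - inv_coeff b)"
      using b by (intro mult_nonneg_nonneg) simp_all
    then show ?thesis using down b by (intro win[of b]) simp_all
  next
    case mid
    have lin: "0 < lin_coeff b"
    proof (cases "U = {}")
      case True
      have "u \<le> b" if "u \<in> breakpoints" for u
        using upto_t[OF that] that True unfolding U_def by blast
      then have "breakpoints \<inter> {b<..} = {}" by force
      then show ?thesis using lin_coeff_last by simp
    next
      case ne: False
      then have "Min U \<in> U" using finU by simp
      then have "0 < t * Min U" using t by (auto simp: U_def)
      moreover have "0 < lin_coeff b * (t * Min U)" using mid(1) ne inv_coeff_nonneg[of b] by linarith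
      ultimately show ?thesis using zero_less_mult_pos2 by blast
    qed
    define w where "w = stationary b"
    have w: "w * w = inv_coeff b / lin_coeff b" "0 \<le> w" "lin_coeff b * (w * w) = inv_coeff b"
      using lin inv_coeff_nonneg[of b] by (auto simp: w_def stationary_def)
    show ?thesis
    proof (cases "w = 0")
      case True
      then have inv: "inv_coeff b = 0" using w lin by simp
      then have "b = 0" using mid(2) lin t b0 by (auto simp: mult_less_0_iff)
      have "0 \<le> (\<Sum>i\<in>{1..n}. load (a i) (c i) (d i) b)"
        using a by (intro sum_nonneg) (auto simp: load_def less_imp_le)
      then have \<sigma>0: "\<sigma> = 0" using inv \<sigma> unfolding inv_coeff_def by linarith
      have "base (a i) (c i) (d i) 0 = min 0 (c i)" if "i \<in> {1..n}" for i
        using a[OF that]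
        by (auto simp: base_def price_def level_def interior_def saturated_def)
      then have "value_at 0 = (\<Sum>i\<in>{1..n}. base (a i) (c i) (d i) b)"
        unfolding value_at_0 using \<sigma>0 \<open>b = 0\<close> by simp
      also have "\<dots> \<le> dual t"
        unfolding dual_t piece_def using lin t inv by simp
      finally show ?thesis using breakpoints by blast
    next
      case False
      then have w0: "0 < w" using w by simp
      have "b \<le> w"
      proof (rule ccontr)
        assume "\<not> b \<le> w"
        then have "0 < b" using w by linarith
        have "w * w \<le> t * b" using w b \<open>\<not> b \<le> w\<close> by (intro mult_mono) simp_all
        then have "lin_coeff b * (w * w) \<le> lin_coeff b * (t * b)" using lin by simp
        then show False using mid(2) w \<open>0 < b\<close> by simp
      qed
      moreover have "breakpoints \<inter> {b<..<w} = {}"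
      proof (rule gap, rule ccontr)
        fix u assume "u \<in> breakpoints" "t < u" "\<not> w \<le> u"
        then have "u \<in> U" by (simp add: U_def)
        then have U: "U \<noteq> {}" "Min U \<in> U" "Min U \<le> u"
          using finU by (auto intro: Min_in)
        then have "t < Min U" "Min U < w" using \<open>\<not> w \<le> u\<close> by (simp_all add: U_def)
        then have "t * Min U \<le> w * w" using t by (intro mult_mono) simp_all
        then have "lin_coeff b * (t * Min U) \<le> lin_coeff b * (w * w)" using lin by simp
        then show False using mid(1) w(3) U(1) by simp
      qed
      moreover have "(t - w) * (lin_coeff b * (t * w) - inv_coeff b) = lin_coeff b * w * (t - w)\<^sup>2"
        unfolding w(3)[symmetric] by (simp add: algebra_simps power2_eq_square)
      then have "0 \<le> (t - w) * (lin_coeff b * (t * w) - inv_coeff b)" using lin w0 by simp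
      moreover have "w \<in> candidates" using b by (simp add: w_def)
      ultimately show ?thesis using w0 by (intro win[of w])
    qed
  qed
qed

lemma best_candidate_optimal:
  assumes "0 \<le> t" and best: "\<And>w. w \<in> candidates \<Longrightarrow> value_at t \<le> value_at w"
    and xy: "\<And>i. i \<in> {1..n} \<Longrightarrow> x i = x_at t i \<and> y i = y_at t i"
  shows "optimal_solution n \<sigma> a c d x y"
proof -
  have feas: "feasible n x y"
    using feasible_candidate[OF assms(1)] xy by (simp add: feasible_def)
  have obj: "objective n \<sigma> a c d x y = value_at t"
    using xy by (simp add: value_at_def objective_def)
  have "value_at t \<le> objective n \<sigma> a c d x' y'" if f: "feasible n x' y'" for x' y'
  proof -
    let ?s = "\<sigma> + (\<Sum>i\<in>{1..n}. a i * (y' i)\<^sup>2)"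
    have "0 \<le> ?s" using \<sigma> a by (intro add_nonneg_nonneg sum_nonneg) (auto simp: less_imp_le)
    then consider "?s = 0" | "0 < ?s" by linarith
    then show ?thesis
    proof cases
      case 1
      then show ?thesis using value_at_0_le_objective[OF f] best[of 0] breakpoints by force
    next
      case 2
      then obtain w where "w \<in> candidates" "value_at w \<le> dual (sqrt ?s)"
        using candidate_below_dual[of "sqrt ?s"] by auto
      then show ?thesis using dual_le_objective[OF f 2] best[of w] by linarith
    qed
  qed
  then show ?thesis
    using feas obj by (auto simp: optimal_solution_def is_arg_min_def not_less)
qed

end

section \<open>The program\<close>

text \<open>
  Array \<open>T\<close> holds the candidates: \<open>0\<close> in cell \<open>0\<close>, the saturation points in \<open>1..n\<close>, the entry points
  in \<open>n+1..2n\<close>, and in cell \<open>2n+1+k\<close> the stationary point computed at candidate \<open>k\<close>. Array \<open>V\<close>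
  holds the values of the candidates, and the index \<open>m\<close> points to the best one so far. Registers
  are arrays of which only cell \<open>0\<close> is used.
\<close>

abbreviation (input) at_i :: "name \<Rightarrow> rexp" where "at_i A \<equiv> RCell A (IVar ''i'')"
abbreviation (input) reg :: "name \<Rightarrow> rexp" where "reg A \<equiv> RCell A (INum 0)"
abbreviation (input) set_i :: "name \<Rightarrow> rexp \<Rightarrow> com" where "set_i A \<equiv> RAssign A (IVar ''i'')"
abbreviation (input) set_reg :: "name \<Rightarrow> rexp \<Rightarrow> com" where "set_reg A \<equiv> RAssign A (INum 0)"
abbreviation (input) set_entry :: "rexp \<Rightarrow> com" where
  "set_entry \<equiv> RAssign ''T'' (IPlus (IVar ''n'') (IVar ''i''))"
abbreviation (input) incr :: "name \<Rightarrow> com" where "incr v \<equiv> IAssign v (IPlus (IVar v) (INum 1))"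
abbreviation (input) i_le_n :: bexp where "i_le_n \<equiv> BNot (ILess (IVar ''n'') (IVar ''i''))"
abbreviation (input) rneg :: "rexp \<Rightarrow> rexp" where "rneg \<equiv> RSub (RConst 0)"

fun block :: "com list \<Rightarrow> com" where
  "block [] = Skip"
| "block [P] = P"
| "block (P # Q # Ps) = Seq P (block (Q # Ps))"

definition breakpoint_body :: com where
  "breakpoint_body = block
    [If (RLess (at_i ''d'') (RConst 0))
       (Seq (set_i ''T'' (RDiv (at_i ''a'') (rneg (at_i ''d''))))
         (If (RLess (RConst 0) (at_i ''c''))
           (If (RLess (rneg (at_i ''d'')) (RMul (RConst 2) (at_i ''c'')))
             (If (RLess (RAdd (at_i ''c'') (at_i ''d'')) (RConst 0))
               (set_entry (RDiv (at_i ''a'') (RMul (RConst (-2)) (RAdd (at_i ''c'') (at_i ''d'')))))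
               (set_entry (RConst 0)))
             (set_entry (RDiv (RMul (RMul (RConst 2) (at_i ''a'')) (at_i ''c''))
                 (RMul (at_i ''d'') (at_i ''d'')))))
           (set_entry (RConst 0))))
       (Seq (set_i ''T'' (RConst 0))
         (set_entry (RConst 0))),
     incr ''i'']"

text \<open>
  Registers \<open>v\<close>, \<open>p\<close>, \<open>q\<close> receive the price of item \<open>i\<close> at candidate \<open>k\<close> and what the item contributes
  to gain and load if it is selected. The division by \<open>2 * t\<close> happens only at saturation, where \<open>t > 0\<close>.
\<close>

definition price_item :: com where
  "price_item =
     If (RLess (at_i ''d'') (RConst 0))
       (If (RLess (RMul (rneg (at_i ''d'')) (RCell ''T'' (IVar ''k''))) (at_i ''a''))
         (block
           [set_i ''y'' (RDiv (RMul (rneg (at_i ''d'')) (RCell ''T'' (IVar ''k''))) (at_i ''a'')),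
            set_reg ''v''
              (RAdd (at_i ''c'') (RDiv (RMul (at_i ''d'') (at_i ''y'')) (RConst 2))),
            set_reg ''p'' (RDiv (RMul (at_i ''d'') (at_i ''d'')) (at_i ''a'')),
            set_reg ''q'' (RConst 0)])
         (block
           [set_i ''y'' (RConst 1),
            set_reg ''v'' (RAdd (RAdd (at_i ''c'') (at_i ''d''))
              (RDiv (at_i ''a'') (RMul (RConst 2) (RCell ''T'' (IVar ''k''))))),
            set_reg ''p'' (RConst 0),
            set_reg ''q'' (at_i ''a'')]))
       (block
         [set_i ''y'' (RConst 0),
          set_reg ''v'' (at_i ''c''),
          set_reg ''p'' (RConst 0),
          set_reg ''q'' (RConst 0)])"

text \<open>
  Registers \<open>A\<close> and \<open>B\<close> accumulate \<open>lin_coeff\<close> and \<open>inv_coeff\<close>; \<open>L\<close> and \<open>S\<close> accumulate the linear part of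
  the objective and the radicand.
\<close>

definition add_item :: com where
  "add_item = block
    [If (RLess (RConst 0) (reg ''v''))
       (block
         [set_i ''x'' (RConst 0),
          set_i ''y'' (RConst 0)])
       (block
         [set_i ''x'' (RConst 1),
          set_reg ''A'' (RSub (reg ''A'') (reg ''p'')),
          set_reg ''B'' (RAdd (reg ''B'') (reg ''q''))]),
     set_reg ''L'' (RAdd (reg ''L'')
       (RAdd (RMul (at_i ''c'') (at_i ''x'')) (RMul (at_i ''d'') (at_i ''y'')))),
     set_reg ''S'' (RAdd (reg ''S'') (RMul (at_i ''a'') (RMul (at_i ''y'') (at_i ''y'')))),
     incr ''i'']"

definition item_body :: com where
  "item_body = Seq price_item add_item"

definition evaluate_prelude :: com where
  "evaluate_prelude = block
    [set_reg ''A'' (RConst 1),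
     set_reg ''B'' (reg ''sigma''),
     set_reg ''L'' (RConst 0),
     set_reg ''S'' (reg ''sigma''),
     IAssign ''i'' (INum 1)]"

abbreviation (input) n_breakpoints :: iexp where
  "n_breakpoints \<equiv> IPlus (IPlus (IVar ''n'') (IVar ''n'')) (INum 1)"

definition evaluate_postlude :: com where
  "evaluate_postlude = block
    [RAssign ''V'' (IVar ''k'') (RAdd (reg ''L'') (RSqrt (reg ''S''))),
     If (RLess (RConst 0) (reg ''A''))
       (RAssign ''T'' (IPlus n_breakpoints (IVar ''k'')) (RSqrt (RDiv (reg ''B'') (reg ''A''))))
       (RAssign ''T'' (IPlus n_breakpoints (IVar ''k'')) (RConst 0))]"

text \<open>
  The stationary point is stored for every candidate, stationary points included. This spares a
  case distinction; only those computed at breakpoints are ever read.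
\<close>

definition evaluate :: com where
  "evaluate = block [evaluate_prelude, While i_le_n item_body, evaluate_postlude]"

definition select :: com where
  "select = block
    [If (RLess (RCell ''V'' (IVar ''k'')) (RCell ''V'' (IVar ''m'')))
       (IAssign ''m'' (IVar ''k'')) Skip,
     incr ''k'']"

text \<open>
  The search loop runs over candidates \<open>0..4n+1\<close> and itself fills the second half of them ahead of
  its counter. It relies on \<open>k\<close>, \<open>m\<close> and cell \<open>0\<close> of \<open>T\<close> being \<open>0\<close> initially. The final evaluation writes the solution of the best candidate to \<open>x\<close> and \<open>y\<close>.
\<close>

definition solver :: com where
  "solver = block
    [IAssign ''i'' (INum 1),
     While i_le_n breakpoint_body,
     While (ILess (IVar ''k'') (IPlus n_breakpoints n_breakpoints)) (Seq evaluate select),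
     IAssign ''k'' (IVar ''m''),
     evaluate]"

definition evaluate_ops :: "nat \<Rightarrow> nat" where
  "evaluate_ops n =
     max_ops evaluate_prelude + (n * max_ops item_body + max_ops evaluate_postlude)"

definition solver_ops :: "nat \<Rightarrow> nat" where
  "solver_ops n = n * max_ops breakpoint_body +
     ((4 * n + 2) * (evaluate_ops n + max_ops select) + evaluate_ops n)"

lemma solver_ops_bigo: "(\<lambda>n. real (solver_ops n)) \<in> O(\<lambda>n. (real n)\<^sup>2)"
proof -
  define K where "K = max_ops breakpoint_body + 7 * (max_ops evaluate_prelude + max_ops item_body
    + max_ops evaluate_postlude + max_ops select)"
  have "solver_ops n \<le> K * n\<^sup>2" if "1 \<le> n" for n
  proof -
    define p where "p = max_ops evaluate_prelude + max_ops item_body + max_ops evaluate_postlude"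
    have sq: "n \<le> n\<^sup>2" using that by (simp add: power2_eq_square)
    have e: "evaluate_ops n \<le> p * n"
      using that by (simp add: evaluate_ops_def p_def algebra_simps add_mono)
    have "(4 * n + 2) * (evaluate_ops n + max_ops select) \<le> (6 * n) * (p * n + max_ops select * n)"
      using that e by (intro mult_mono add_mono) auto
    also have "\<dots> = (6 * p + 6 * max_ops select) * n\<^sup>2"
      by (simp add: power2_eq_square algebra_simps)
    finally have "solver_ops n \<le> max_ops breakpoint_body * n
        + ((6 * p + 6 * max_ops select) * n\<^sup>2 + p * n)"
      using e by (simp add: solver_ops_def mult.commute)
    also have "\<dots> \<le> max_ops breakpoint_body * n\<^sup>2
        + ((6 * p + 6 * max_ops select) * n\<^sup>2 + p * n\<^sup>2)"
      using sq by (intro add_mono mult_left_mono) auto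
    also have "\<dots> \<le> K * n\<^sup>2" by (simp add: K_def p_def algebra_simps)
    finally show ?thesis .
  qed
  then have "\<forall>\<^sub>F n in sequentially. norm (real (solver_ops n)) \<le> real K * norm ((real n)\<^sup>2)"
    by (intro eventually_sequentiallyI[of 1])
      (simp flip: of_nat_power of_nat_mult)
  then show ?thesis by (rule bigoI)
qed

section \<open>Correctness of the program\<close>

lemma wp_price_item:
  assumes s: "ivar s ''i'' = i" "rarr s ''a'' i = a" "rarr s ''c'' i = c"
    "rarr s ''d'' i = d" "rarr s ''T'' (ivar s ''k'') = t"
    and "0 < a"
    and Q: "Q (s\<lparr>rarr := (rarr s)(''y'' := (rarr s ''y'')(i := level a d t),
      ''v'' := (rarr s ''v'')(0 := price a c d t),
      ''p'' := (rarr s ''p'')(0 := if interior a d t then d * d / a else 0),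
      ''q'' := (rarr s ''q'')(0 := if saturated a d t then a else 0))\<rparr>)"
  shows "wp price_item Q s"
proof -
  consider (i) "d < 0" "- d * t < a" | (s) "d < 0" "\<not> - d * t < a" | (n) "\<not> d < 0" by linarith
  then show ?thesis
  proof cases
    case i
    then show ?thesis using Q s \<open>0 < a\<close>
      by (simp add: price_item_def price_def level_def interior_def saturated_def)
  next
    case s
    then have "t \<noteq> 0" using \<open>0 < a\<close> by auto
    with s show ?thesis using Q assms(1-6)
      by (simp add: price_item_def price_def level_def interior_def saturated_def)
  next
    case n
    then show ?thesis using Q s
      by (simp add: price_item_def price_def level_def interior_def saturated_def)
  qed
qed

context mean_risk
begin

definition holds_input :: "state \<Rightarrow> bool" where
  "holds_input s \<longleftrightarrow> ivar s ''n'' = n \<and> rarr s ''sigma'' 0 = \<sigma> \<and>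
     (\<forall>i\<in>{1..n}. rarr s ''a'' i = a i \<and> rarr s ''c'' i = c i \<and> rarr s ''d'' i = d i)"

definition breakpoint :: "nat \<Rightarrow> real" where
  "breakpoint j =
     (if j = 0 then 0
      else if j \<le> n then saturation_point (a j) (d j)
      else entry_point (a (j - n)) (c (j - n)) (d (j - n)))"

lemma breakpoint_range: "breakpoint ` {..2 * n} = breakpoints"
proof
  show "breakpoint ` {..2 * n} \<subseteq> breakpoints"
    by (auto simp: breakpoint_def breakpoints_def image_iff) force+
  have "0 = breakpoint 0" by (simp add: breakpoint_def)
  moreover have "saturation_point (a i) (d i) = breakpoint i"
    "entry_point (a i) (c i) (d i) = breakpoint (n + i)" if "i \<in> {1..n}" for i
    using that by (auto simp: breakpoint_def)
  ultimately show "breakpoints \<subseteq> breakpoint ` {..2 * n}"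
    unfolding breakpoints_def by (force intro: imageI)
qed

definition breakpoint_inv :: "nat \<Rightarrow> state \<Rightarrow> bool" where
  "breakpoint_inv i s \<longleftrightarrow> holds_input s \<and> ivar s ''i'' = i \<and> ivar s ''k'' = 0 \<and> ivar s ''m'' = 0 \<and>
     rarr s ''T'' 0 = 0 \<and>
     (\<forall>j\<in>{1..<i}. rarr s ''T'' j = breakpoint j \<and> rarr s ''T'' (n + j) = breakpoint (n + j))"

lemma runs_breakpoint_body:
  assumes "1 \<le> i" "i \<le> n" "breakpoint_inv i s"
  shows "runs breakpoint_body s (max_ops breakpoint_body) (breakpoint_inv (Suc i))"
proof (rule runs_wp)
  have i: "ivar s ''i'' = i" "ivar s ''n'' = n" "rarr s ''a'' i = a i" "rarr s ''c'' i = c i"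
    "rarr s ''d'' i = d i"
    using assms by (auto simp: breakpoint_inv_def holds_input_def)
  have T: "breakpoint i = saturation_point (a i) (d i)"
     "breakpoint (n + i) = entry_point (a i) (c i) (d i)"
    using assms by (auto simp: breakpoint_def)
  have ext: "breakpoint_inv (Suc i) (s\<lparr>rarr := (rarr s)(''T'' := T'), ivar := (ivar s)(''i'' := Suc i)\<rparr>)"
    if "T' = (rarr s ''T'')(i := breakpoint i, n + i := breakpoint (n + i))" for T'
    using assms unfolding that breakpoint_inv_def holds_input_def by (auto simp: less_Suc_eq)
  show "wp breakpoint_body (breakpoint_inv (Suc i)) s"
    unfolding breakpoint_body_def
    using ext i T by (auto simp: saturation_point_def entry_point_def)
qed

text \<open>State \<open>s0\<close> is the one in which the evaluation started; the rest is the progress after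
  the items below \<open>i\<close>.\<close>

definition item_inv :: "state \<Rightarrow> nat \<Rightarrow> state \<Rightarrow> bool" where
  "item_inv s0 i s \<longleftrightarrow>
     (let t = rarr s0 ''T'' (ivar s0 ''k'') in
       (\<forall>A \<in> {''sigma'', ''a'', ''c'', ''d'', ''T'', ''V''}. rarr s A = rarr s0 A) \<and>
       (\<forall>v \<in> {''n'', ''k'', ''m''}. ivar s v = ivar s0 v) \<and>
       ivar s ''i'' = i \<and>
       (\<forall>j\<in>{1..<i}. rarr s ''x'' j = x_at t j \<and> rarr s ''y'' j = y_at t j) \<and>
       rarr s ''A'' 0 = 1 - (\<Sum>j\<in>{1..<i}. gain (a j) (c j) (d j) t) \<and>
       rarr s ''B'' 0 = \<sigma> + (\<Sum>j\<in>{1..<i}. load (a j) (c j) (d j) t) \<and>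
       rarr s ''L'' 0 = (\<Sum>j\<in>{1..<i}. c j * x_at t j + d j * y_at t j) \<and>
       rarr s ''S'' 0 = \<sigma> + (\<Sum>j\<in>{1..<i}. a j * (y_at t j)\<^sup>2))"

lemma runs_item_body:
  assumes "1 \<le> i" "i \<le> n" "holds_input s0" "item_inv s0 i s"
  shows "runs item_body s (max_ops item_body) (item_inv s0 (Suc i))"
proof (rule runs_wp)
  define t where "t = rarr s0 ''T'' (ivar s0 ''k'')"
  note inv = assms(4)[unfolded item_inv_def Let_def t_def[symmetric]]
  have i: "ivar s ''i'' = i" "rarr s ''a'' i = a i" "rarr s ''c'' i = c i"
    "rarr s ''d'' i = d i" "rarr s ''T'' (ivar s ''k'') = t"
    using assms inv by (auto simp: holds_input_def t_def)
  have upd: "{Suc 0..<Suc i} = insert i {Suc 0..<i}" using assms by auto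
  show "wp item_body (item_inv s0 (Suc i)) s"
    unfolding item_body_def wp.simps
  proof (rule wp_price_item[where i = i and t = t, OF i])
    show "0 < a i" using a assms by auto
    let ?s = "s\<lparr>rarr := (rarr s)(''y'' := (rarr s ''y'')(i := level (a i) (d i) t),
      ''v'' := (rarr s ''v'')(0 := price (a i) (c i) (d i) t),
      ''p'' := (rarr s ''p'')(0 := if interior (a i) (d i) t then d i * d i / a i else 0),
      ''q'' := (rarr s ''q'')(0 := if saturated (a i) (d i) t then a i else 0))\<rparr>"
    show "wp add_item (item_inv s0 (Suc i)) ?s"
    proof (cases "price (a i) (c i) (d i) t \<le> 0")
      case True
      then show ?thesis
        unfolding item_inv_def Let_def t_def[symmetric]
        using inv i assms(1)
        by (auto simp: add_item_def upd x_at_def y_at_def gain_def load_def power2_eq_square)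
    next
      case False
      then show ?thesis
        unfolding item_inv_def Let_def t_def[symmetric]
        using inv i assms(1)
        by (auto simp: add_item_def upd x_at_def y_at_def gain_def load_def power2_eq_square)
    qed
  qed
qed

lemma runs_evaluate:
  assumes "holds_input s"
  defines "t \<equiv> rarr s ''T'' (ivar s ''k'')"
  shows "runs evaluate s (evaluate_ops n)
    (\<lambda>s'. holds_input s' \<and> ivar s' ''k'' = ivar s ''k'' \<and> ivar s' ''m'' = ivar s ''m'' \<and>
       (\<forall>i\<in>{1..n}. rarr s' ''x'' i = x_at t i \<and> rarr s' ''y'' i = y_at t i) \<and>
       rarr s' ''V'' = (rarr s ''V'')(ivar s ''k'' := value_at t) \<and>
       rarr s' ''T'' = (rarr s ''T'')(2 * n + 1 + ivar s ''k'' := stationary t))"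
    (is "runs _ _ _ ?Q")
proof -
  have 1: "runs evaluate_prelude s (max_ops evaluate_prelude) (item_inv s 1)"
    using assms by (intro runs_wp) (simp add: evaluate_prelude_def item_inv_def holds_input_def)
  have 2: "runs (While i_le_n item_body) s' (n * max_ops item_body) (item_inv s (Suc n))"
    if "item_inv s 1 s'" for s'
  proof -
    have "runs (While i_le_n item_body) s' ((Suc n - 1) * max_ops item_body) (item_inv s (Suc n))"
    proof (rule runs_for)
      fix i s'' assume "i \<le> Suc n" "item_inv s i s''"
      then show "bdef i_le_n s'' \<and> bval i_le_n s'' = (i < Suc n)"
        using assms by (auto simp: item_inv_def holds_input_def Let_def)
    qed (use that assms runs_item_body in auto)
    then show ?thesis by simp
  qed
  have 3: "runs evaluate_postlude s' (max_ops evaluate_postlude) ?Q"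
    if "item_inv s (Suc n) s'" for s'
  proof (rule runs_wp)
    note inv = that[unfolded item_inv_def Let_def t_def[symmetric]]
    have V: "rarr s' ''L'' 0 + sqrt (rarr s' ''S'' 0) = value_at t"
      using inv by (simp add: value_at_def objective_def sum.distrib atLeastLessThanSuc_atLeastAtMost)
    have S: "0 \<le> rarr s' ''S'' 0"
      using inv \<sigma> a by (auto intro!: add_nonneg_nonneg sum_nonneg simp: less_imp_le)
    have AB: "rarr s' ''A'' 0 = lin_coeff t" "rarr s' ''B'' 0 = inv_coeff t"
      using inv by (simp_all add: lin_coeff_def inv_coeff_def atLeastLessThanSuc_atLeastAtMost)
    show "wp evaluate_postlude ?Q s'"
      unfolding evaluate_postlude_def
      using inv V S AB inv_coeff_nonneg[of t] assms(1)
      by (auto simp: stationary_def holds_input_def mult_2)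
  qed
  show ?thesis
    unfolding evaluate_def evaluate_ops_def block.simps
    by (intro runs_Seq[OF 1] runs_Seq[OF 2] 3)
qed

text \<open>
  Cells of \<open>T\<close> are described through other cells of \<open>T\<close>. This is stable, because round \<open>k\<close> writes only
  cell \<open>2n+1+k\<close>, which no earlier clause mentions.
\<close>

definition search_inv :: "nat \<Rightarrow> state \<Rightarrow> bool" where
  "search_inv k s \<longleftrightarrow> holds_input s \<and> ivar s ''k'' = k \<and> (0 < k \<longrightarrow> ivar s ''m'' < k) \<and>
     (k = 0 \<longrightarrow> ivar s ''m'' = 0) \<and>
     (\<forall>j\<in>{..2 * n}. rarr s ''T'' j = breakpoint j) \<and>
     (\<forall>j<k. rarr s ''T'' (2 * n + 1 + j) = stationary (rarr s ''T'' j) \<and>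
       rarr s ''V'' j = value_at (rarr s ''T'' j) \<and>
       rarr s ''V'' (ivar s ''m'') \<le> rarr s ''V'' j)"

lemma search_invD:
  assumes "search_inv k s"
  shows "holds_input s" "ivar s ''k'' = k" "0 < k \<Longrightarrow> ivar s ''m'' < k" "k = 0 \<Longrightarrow> ivar s ''m'' = 0"
    "\<And>j. j \<le> 2 * n \<Longrightarrow> rarr s ''T'' j = breakpoint j"
    "\<And>j. j < k \<Longrightarrow> rarr s ''T'' (2 * n + 1 + j) = stationary (rarr s ''T'' j)"
    "\<And>j. j < k \<Longrightarrow> rarr s ''V'' j = value_at (rarr s ''T'' j)"
    "\<And>j. j < k \<Longrightarrow> rarr s ''V'' (ivar s ''m'') \<le> rarr s ''V'' j"
  using assms unfolding search_inv_def Ball_def atMost_iff by blast+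

lemma runs_search_body:
  assumes "search_inv k s"
  shows "runs (Seq evaluate select) s (evaluate_ops n + max_ops select) (search_inv (Suc k))"
proof (rule runs_Seq[OF runs_evaluate])
  show "holds_input s" using assms by (simp add: search_inv_def)
  define T V m where "T = rarr s ''T''" and "V = rarr s ''V''" and "m = ivar s ''m''"
  have k: "ivar s ''k'' = k" and T0: "\<forall>j\<in>{..2 * n}. T j = breakpoint j"
    and m: "0 < k \<longrightarrow> m < k" "k = 0 \<longrightarrow> m = 0"
    and old: "\<forall>j<k. T (2 * n + 1 + j) = stationary (T j) \<and> V j = value_at (T j) \<and> V m \<le> V j"
    unfolding T_def V_def m_def using search_invD[OF assms] by blast+
  define T' V' where "T' = T(2 * n + 1 + k := stationary (T k))" and "V' = V(k := value_at (T k))"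
  have T'0: "\<forall>j\<in>{..2 * n}. T' j = breakpoint j" using T0 by (simp add: T'_def)
  have new: "\<forall>j<Suc k. T' (2 * n + 1 + j) = stationary (T' j) \<and> V' j = value_at (T' j)"
    using old by (simp add: T'_def V'_def less_Suc_eq)
  define m' where "m' = (if V' k < V' m then k else m)"
  have m': "m' < Suc k" using m by (auto simp: m'_def)
  have best: "\<forall>j<Suc k. V' m' \<le> V' j"
  proof (cases "k = 0")
    case True
    then show ?thesis using m by (simp add: m'_def)
  next
    case False
    have "\<forall>j<k. V m \<le> V j" using old by blast
    then have "\<forall>j<k. V' m \<le> V' j" using m False by (simp add: V'_def)
    then show ?thesis by (force simp: m'_def less_Suc_eq)
  qed
  fix s' :: state
  assume s': "holds_input s' \<and> ivar s' ''k'' = ivar s ''k'' \<and> ivar s' ''m'' = ivar s ''m'' \<and>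
       (\<forall>i\<in>{1..n}. rarr s' ''x'' i = x_at (rarr s ''T'' (ivar s ''k'')) i \<and>
          rarr s' ''y'' i = y_at (rarr s ''T'' (ivar s ''k'')) i) \<and>
       rarr s' ''V'' = (rarr s ''V'')(ivar s ''k'' := value_at (rarr s ''T'' (ivar s ''k''))) \<and>
       rarr s' ''T'' = (rarr s ''T'')
         (2 * n + 1 + ivar s ''k'' := stationary (rarr s ''T'' (ivar s ''k'')))"
  have arrays: "rarr s' ''T'' = T'" "rarr s' ''V'' = V'" "ivar s' ''k'' = k" "ivar s' ''m'' = m"
    using s' k by (simp_all add: T'_def V'_def T_def V_def m_def)
  have "search_inv (Suc k) s''"
    if "ivar s'' ''n'' = ivar s' ''n''" "rarr s'' = rarr s'" "ivar s'' ''k'' = Suc k"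
      "ivar s'' ''m'' = m'" for s''
    unfolding search_inv_def using that s' arrays T'0 new m' best by (simp add: holds_input_def)
  then show "runs select s' (max_ops select) (search_inv (Suc k))"
    using arrays by (intro runs_wp) (simp add: select_def m'_def)
qed

lemma solver_correct:
  assumes "holds_input s" "rarr s ''T'' 0 = 0" "ivar s ''k'' = 0" "ivar s ''m'' = 0"
  shows "runs solver s (solver_ops n)
     (\<lambda>s. optimal_solution n \<sigma> a c d (rarr s ''x'') (rarr s ''y''))" (is "runs _ _ _ ?Q")
proof -
  have 1: "runs (IAssign ''i'' (INum 1)) s 0 (breakpoint_inv 1)"
    using runs_wp[of "IAssign ''i'' (INum 1)" "breakpoint_inv 1" s] assms
    by (simp add: breakpoint_inv_def holds_input_def)
  have 2: "runs (While i_le_n breakpoint_body) s' (n * max_ops breakpoint_body) (breakpoint_inv (Suc n))"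
    if "breakpoint_inv 1 s'" for s'
  proof -
    have "runs (While i_le_n breakpoint_body) s' ((Suc n - 1) * max_ops breakpoint_body)
      (breakpoint_inv (Suc n))"
    proof (rule runs_for)
      fix i s'' assume "i \<le> Suc n" "breakpoint_inv i s''"
      then show "bdef i_le_n s'' \<and> bval i_le_n s'' = (i < Suc n)"
        by (auto simp: breakpoint_inv_def holds_input_def)
    qed (use that runs_breakpoint_body in auto)
    then show ?thesis by simp
  qed
  let ?b = "ILess (IVar ''k'') (IPlus n_breakpoints n_breakpoints)"
  have 3: "runs (While ?b (Seq evaluate select)) s' ((4 * n + 2) * (evaluate_ops n + max_ops select))
      (search_inv (4 * n + 2))"
    if "breakpoint_inv (Suc n) s'" for s'
  proof -
    have "runs (While ?b (Seq evaluate select)) s' ((4 * n + 2 - 0) * (evaluate_ops n + max_ops select))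
      (search_inv (4 * n + 2))"
    proof (rule runs_for)
      have "rarr s' ''T'' j = breakpoint j" if "j \<le> 2 * n" for j
      proof -
        consider "j = 0" | "j \<in> {1..n}" | "n < j" "j - n \<in> {1..n}"
          using \<open>j \<le> 2 * n\<close> by fastforce
        then show ?thesis
        proof cases
          case 3
          then have "j = n + (j - n)" by simp
          then show ?thesis using \<open>breakpoint_inv (Suc n) s'\<close> 3 unfolding breakpoint_inv_def
            by (metis atLeastAtMost_iff atLeastLessThan_iff less_Suc_eq_le)
        qed (use \<open>breakpoint_inv (Suc n) s'\<close> in \<open>auto simp: breakpoint_inv_def breakpoint_def\<close>)
      qed
      moreover have "holds_input s'" "ivar s' ''k'' = 0" "ivar s' ''m'' = 0"
        using that by (simp_all add: breakpoint_inv_def)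
      ultimately show "search_inv 0 s'" by (simp add: search_inv_def)
    next
      fix k s'' assume inv: "search_inv k s''"
      then have "ivar s'' ''n'' = n" "ivar s'' ''k'' = k"
        using search_invD(1,2)[OF inv] by (simp_all add: holds_input_def)
      then show "bdef ?b s'' \<and> bval ?b s'' = (k < 4 * n + 2)" by auto
    qed (auto intro: runs_search_body)
    then show ?thesis by simp
  qed
  have 4: "runs (IAssign ''k'' (IVar ''m'')) s' 0
     (\<lambda>s. holds_input s \<and> 0 \<le> rarr s ''T'' (ivar s ''k'') \<and>
       (\<forall>w \<in> candidates. value_at (rarr s ''T'' (ivar s ''k'')) \<le> value_at w))"
    (is "runs _ _ _ ?R")
    if "search_inv (4 * n + 2) s'" for s'
  proof -
    define T m where "T = rarr s' ''T''" and "m = ivar s' ''m''"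
    note inv = search_invD[OF that]
    have m: "m < 4 * n + 2" using inv(3) unfolding m_def by simp
    have bp: "T j = breakpoint j" if "j \<le> 2 * n" for j
      using inv(5)[OF that] unfolding T_def .
    have st: "T (2 * n + 1 + j) = stationary (T j)" "value_at (T m) \<le> value_at (T j)"
      if "j < 4 * n + 2" for j
      using inv(6)[OF that] inv(8)[OF that] inv(7)[OF that] inv(7)[OF m]
      unfolding T_def m_def by simp_all
    have "0 \<le> T m"
    proof (cases "m \<le> 2 * n")
      case True
      then show ?thesis using bp[OF True] breakpoints(3) breakpoint_range by auto
    next
      case False
      then have "m = 2 * n + 1 + (m - (2 * n + 1))" by simp
      then show ?thesis using st(1)[of "m - (2 * n + 1)"] m stationary_nonneg
        by (metis less_imp_diff_less)
    qed
    moreover have "value_at (T m) \<le> value_at w" if w: "w \<in> candidates" for w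
    proof -
      obtain j where j: "j \<le> 2 * n" "w = breakpoint j \<or> w = stationary (breakpoint j)"
        using w unfolding breakpoint_range[symmetric] by auto
      then have "w = T j \<or> w = T (2 * n + 1 + j)" using bp[of j] st(1)[of j] by auto
      then show ?thesis using st(2)[of j] st(2)[of "2 * n + 1 + j"] j(1) by auto
    qed
    ultimately have "?R (s'\<lparr>ivar := (ivar s')(''k'' := m)\<rparr>)"
      using inv(1) unfolding holds_input_def T_def by simp
    then have "wp (IAssign ''k'' (IVar ''m'')) ?R s'" unfolding m_def by simp
    then have "runs (IAssign ''k'' (IVar ''m'')) s' (max_ops (IAssign ''k'' (IVar ''m''))) ?R"
      by (rule runs_wp)
    then show ?thesis unfolding max_ops.simps .
  qed
  have 5: "runs evaluate s' (evaluate_ops n) ?Q" if R: "?R s'" for s'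
  proof -
    define t where "t = rarr s' ''T'' (ivar s' ''k'')"
    have t: "value_at t \<le> value_at w" if "w \<in> candidates" for w
      using R that unfolding t_def by blast
    have opt: "?Q s''"
      if "\<forall>i\<in>{1..n}. rarr s'' ''x'' i = x_at t i \<and> rarr s'' ''y'' i = y_at t i" for s''
    proof (rule best_candidate_optimal)
      show "0 \<le> t" using R unfolding t_def by blast
    qed (use t that in blast)+
    have "holds_input s'" using R by blast
    then show ?thesis
      by (rule runs_mono[OF runs_evaluate order_refl], intro opt[unfolded t_def]) blast
  qed
  have "runs solver s
     (0 + (n * max_ops breakpoint_body +
       ((4 * n + 2) * (evaluate_ops n + max_ops select) + (0 + evaluate_ops n)))) ?Q"
    unfolding solver_def block.simps
    by (intro runs_Seq[OF 1] runs_Seq[OF 2] runs_Seq[OF 3] runs_Seq[OF 4] 5)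
  then show ?thesis by (simp only: solver_ops_def add_0)
qed

end

theorem proposition5:
  "\<exists>(P :: com) (T :: nat \<Rightarrow> nat).
     (\<lambda>n. real (T n)) \<in> O(\<lambda>n. (real n)\<^sup>2) \<and>
     (\<forall>(n :: nat) (\<sigma> :: real) (a :: nat \<Rightarrow> real) (c :: nat \<Rightarrow> real) (d :: nat \<Rightarrow> real).
        n \<ge> 1 \<longrightarrow> \<sigma> \<ge> 0 \<longrightarrow> (\<forall>i\<in>{1..n}. a i > 0) \<longrightarrow>
        (\<exists>t s. exec P (input_state n \<sigma> a c d) t s \<and> t \<le> T n \<and>
               optimal_solution n \<sigma> a c d (rarr s ''x'') (rarr s ''y'')))"
proof (rule exI[of _ solver], rule exI[of _ solver_ops], intro conjI allI impI)
  show "(\<lambda>n. real (solver_ops n)) \<in> O(\<lambda>n. (real n)\<^sup>2)" by (rule solver_ops_bigo)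
  fix n :: nat and \<sigma> :: real and a c d :: "nat \<Rightarrow> real"
  assume "n \<ge> 1" "\<sigma> \<ge> 0" "\<forall>i\<in>{1..n}. a i > 0"
  then interpret mean_risk n \<sigma> a c d by unfold_locales auto
  let ?s = "input_state n \<sigma> a c d"
  have "holds_input ?s" "rarr ?s ''T'' 0 = 0" "ivar ?s ''k'' = 0" "ivar ?s ''m'' = 0"
    by (simp_all add: holds_input_def input_state_def)
  then show "\<exists>t s. exec solver ?s t s \<and> t \<le> solver_ops n \<and>
      optimal_solution n \<sigma> a c d (rarr s ''x'') (rarr s ''y'')"
    using solver_correct[of ?s] unfolding runs_def by blast
qed

end
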